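(* For all positive integers $k\ge 4$ and $s$, let $n=2sk+1$ and let $G$ be the complete graph on vertex set $\{0,1,\ldots,n-1\}$. Then there are $k$ circle graphs $C_1,\ldots,C_k$, each on $n$ vertices, such that $E(C_1),\ldots,E(C_k)$ form a partition of $E(G)$ and such that for every $1\le i\le k$, the largest diameter two subgraph of $C_i$ contains at most $2s+7$ vertices.
   Context: For an integer $n\ge 2$ and a set $S\subseteq\{1,\ldots,\lfloor n/2\rfloor\}$, the circle graph on $n$ vertices determined by $S$ is the graph with vertex set $\{0,1,\ldots,n-1\}$ in which two vertices $x,y$ are adjacent if and only if $(x-y)\bmod n\in S$ or $(y-x)\bmod n\in S$. A diameter two subgraph of a graph $G$ is a subgraph $H$ of $G$ such that for every pair of vertices $x,y$ of $H$ there is a path in $H$ joining $x$ and $y$ with at most two edges; its size is its number of vertices. *)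

theory Defs
  imports "Graph_Theory.Graph_Theory" "HOL-Library.Disjoint_Sets"
begin

(* An undirected graph is a symmetric loop-free digraph: the edge {x, y} is the pair of arcs
   (x, y), (y, x). Vertices are integers because mod on nat would not give the residue of x - y. *)
definition circle_graph :: "nat \<Rightarrow> int set \<Rightarrow> int pair_pre_digraph" where
  "circle_graph n S =
    \<lparr> pverts = {0..<int n},
      parcs = {(x, y). x \<in> {0..<int n} \<and> y \<in> {0..<int n} \<and>
                       ((x - y) mod int n \<in> S \<or> (y - x) mod int n \<in> S)} \<rparr>"

definition is_circle_graph :: "nat \<Rightarrow> int pair_pre_digraph \<Rightarrow> bool" where
  "is_circle_graph n C \<longleftrightarrow>
    n \<ge> 2 \<and> (\<exists>S. S \<subseteq> {1..\<lfloor>real n / 2\<rfloor>} \<and> C = circle_graph n S)"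

lemma is_circle_graph_imp_pair_graph:
  assumes "is_circle_graph n C"
  shows "pair_graph C"
proof -
  obtain S where S: "S \<subseteq> {1..\<lfloor>real n / 2\<rfloor>}" and C: "C = circle_graph n S"
    using assms unfolding is_circle_graph_def by blast
  have "finite (parcs C)"
    by (rule finite_subset[of _ "{0..<int n} \<times> {0..<int n}"]) (auto simp: C circle_graph_def)
  moreover have "0 \<notin> S" using S by auto
  ultimately show ?thesis
    by unfold_locales (auto simp: C circle_graph_def symmetric_def sym_def)
qed

(* subgraph alone would allow H to keep one orientation of an edge without the other;
   graph H excludes this, so that H is again an undirected graph. *)
definition diameter_two_subgraph :: "('a, 'b) pre_digraph \<Rightarrow> ('a, 'b) pre_digraph \<Rightarrow> bool" where
  "diameter_two_subgraph H G \<longleftrightarrow>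
    subgraph H G \<and> graph H \<and>
    (\<forall>x \<in> verts H. \<forall>y \<in> verts H. \<exists>p. pre_digraph.apath H x p y \<and> length p \<le> 2)"

end

theory Submission
  imports Defs "HOL-Number_Theory.Cong"
begin

text \<open>Distances are classified by their residue modulo \<open>2 * k\<close>, identifying \<open>x\<close> with \<open>1 - x\<close>.
  Since \<open>n \<equiv> 1\<close> modulo \<open>2 * k\<close>, the classes are invariant under \<open>d \<mapsto> n - d\<close>. If \<open>u < v\<close> are vertices of
  a diameter two subgraph \<open>H\<close> of class \<open>c\<close>, then \<open>v - u\<close> takes one of eight residues, so, seen from
  its least vertex, \<open>H\<close> meets at most eight residue classes. For most \<open>c\<close> no integer lies in the hulls
  of three of these residue classes of \<open>H\<close>: hulls overlap only if the difference of the residues is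
  allowed in both directions. Hence the hulls have total length less than \<open>2 * (2 * k * s)\<close>, and since
  each residue class is \<open>2 * k\<close>-separated, \<open>2 * k * |H| < 2 * (2 * k * s) + 8 * (2 * k)\<close>.

  The class \<open>c = 2 * k / 3\<close> really contains a diameter two subgraph on \<open>3 * s\<close> vertices. If \<open>3\<close> divides
  \<open>k\<close>, the union of the classes \<open>1\<close>, \<open>2 * k / 3\<close>, \<open>2 * k / 3 + 1\<close> is the preimage under \<open>d \<mapsto> 3 * d\<close> of the
  union of the classes \<open>1\<close>, \<open>2\<close>, \<open>3\<close>, and is split accordingly; dilations are graph isomorphisms. If \<open>3\<close>
  does not divide \<open>k\<close>, the classes \<open>1\<close> and \<open>2\<close> are likewise replaced by dilates of \<open>1\<close> and \<open>k\<close>, because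
  class \<open>2\<close> is only controlled for \<open>k \<ge> 6\<close>.\<close>

section \<open>Folded residue classes and the allowed differences\<close>

section \<open>Diameter two sets of integers\<close>

text \<open>Residue 0 belongs with 1, its image under x -> 1 - x, but neither \<open>r\<close> nor
  \<open>2 * k + 1 - r\<close> gives 1 there; hence the separate case. The residues above
  \<open>k\<close> reflect into \<open>{2..k}\<close>.\<close>

definition fold_class :: "int \<Rightarrow> int \<Rightarrow> int" where
  "fold_class k x =
    (let r = x mod (2 * k) in if r = 0 then 1 else if r \<le> k then r else 2 * k + 1 - r)"

lemma fold_class_range: "k \<ge> 1 \<Longrightarrow> fold_class k x \<in> {1..k}"
  using pos_mod_bound[of "2 * k" x] pos_mod_sign[of "2 * k" x]
  unfolding fold_class_def Let_def by (smt (verit) atLeastAtMost_iff)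

lemma fold_class_cong:
  assumes "k \<ge> 1" "fold_class k x = c"
  shows "[x = c] (mod 2 * k) \<or> [x = 1 - c] (mod 2 * k)"
proof -
  define r where "r = x mod (2 * k)"
  have "[x = r] (mod 2 * k)" by (simp add: r_def cong_def)
  moreover have "r = c \<or> r = 1 - c \<or> r = 2 * k + (1 - c)"
    using assms by (auto simp: fold_class_def Let_def r_def split: if_splits)
  moreover have "[2 * k + (1 - c) = 1 - c] (mod 2 * k)" by (simp add: cong_def)
  ultimately show ?thesis by (metis cong_trans)
qed

lemma fold_class_cong_mod: "[x = y] (mod 2 * k) \<Longrightarrow> fold_class k x = fold_class k y"
  by (simp add: fold_class_def cong_def)

lemma fold_class_reflect: 
  assumes "k \<ge> 1" shows "fold_class k (1 - x) = fold_class k x"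
proof -
  define r where "r = x mod (2 * k)"
  have r: "0 \<le> r" "r < 2 * k" using assms by (auto simp: r_def)
  have "(1 - x) mod (2 * k) = (1 - r) mod (2 * k)" by (simp add: r_def mod_diff_right_eq)
  also have "\<dots> = (if r = 0 \<or> r = 1 then 1 - r else 2 * k + 1 - r)"
  proof (cases "r = 0 \<or> r = 1")
    case True then show ?thesis using assms by auto
  next
    case False
    have "(1 - r) mod (2 * k) = (1 - r + 2 * k) mod (2 * k)" by simp
    also have "\<dots> = 2 * k + 1 - r" using r False by (subst mod_pos_pos_trivial) auto
    finally show ?thesis using False by simp
  qed
  finally show ?thesis using r assms unfolding fold_class_def Let_def r_def[symmetric] by auto
qed

lemma fold_class_eq_self: "1 \<le> c \<Longrightarrow> c \<le> k \<Longrightarrow> fold_class k c = c"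
  by (simp add: fold_class_def)

text \<open>Ordinary distance replaces cyclic distance: folded classes do not distinguish d from n -
  d when n is 1 modulo \<open>2 * k\<close>, so nothing is lost and the order of the integers
  becomes available.\<close>

definition two_step :: "int \<Rightarrow> int \<Rightarrow> int set \<Rightarrow> bool" where
  "two_step k c H \<longleftrightarrow> (\<forall>u\<in>H. \<forall>v\<in>H. u \<noteq> v \<longrightarrow>
     fold_class k \<bar>u - v\<bar> = c \<or>
     (\<exists>w\<in>H. fold_class k \<bar>u - w\<bar> = c \<and> fold_class k \<bar>w - v\<bar> = c))"

text \<open>After 0 come the residues of one edge, then the sums and differences of two of them. In
  general the set is not closed under negation, and this restricts overlaps of hulls.\<close>

definition step_residues :: "int \<Rightarrow> int set" where
  "step_residues c = {0, c, 1 - c, 1, 2 * c, 2 - 2 * c, 2 * c - 1, 1 - 2 * c}"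

lemma finite_step_residues: "finite (step_residues c)"
  by (simp add: step_residues_def)

text \<open>The midpoint \<open>w\<close> either separates \<open>u\<close> from \<open>v\<close>,
  and the two distances add, or lies outside, and they subtract. Since \<open>u < v\<close>, the
  sums never occur with a negative sign.\<close>

lemma two_step_residue:
  assumes k: "k \<ge> 1" and H: "two_step k c H" and uv: "u \<in> H" "v \<in> H" "u < v"
  shows "\<exists>a\<in>step_residues c. [v - u = a] (mod 2 * k)"
proof -
  have abs: "\<bar>u - v\<bar> = v - u" and ne: "u \<noteq> v" using uv(3) by simp_all
  consider "fold_class k \<bar>u - v\<bar> = c"
    | w where "fold_class k \<bar>u - w\<bar> = c" "fold_class k \<bar>w - v\<bar> = c"
    using H[unfolded two_step_def, THEN bspec, OF uv(1), THEN bspec, OF uv(2), THEN mp, OF ne]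
    by blast
  then show ?thesis
  proof cases
    case 1
    then show ?thesis using fold_class_cong[OF k 1] by (auto simp: step_residues_def abs)
  next
    case (2 w)
    obtain a where a: "a = c \<or> a = 1 - c" "[\<bar>u - w\<bar> = a] (mod 2 * k)"
      using fold_class_cong[OF k 2(1)] by blast
    obtain b where b: "b = c \<or> b = 1 - c" "[\<bar>w - v\<bar> = b] (mod 2 * k)"
      using fold_class_cong[OF k 2(2)] by blast
    consider "w \<le> u" | "u \<le> w" "w \<le> v" | "v \<le> w" by linarith
    then show ?thesis
    proof cases
      case 1
      then have eq: "v - u = \<bar>w - v\<bar> - \<bar>u - w\<bar>" using uv(3) by arith
      have "[v - u = b - a] (mod 2 * k)" unfolding eq by (rule cong_diff[OF b(2) a(2)])
      moreover have "b - a \<in> step_residues c"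
        using a(1) b(1) unfolding step_residues_def insert_iff by (smt (verit))
      ultimately show ?thesis by (rule bexI)
    next
      case 2
      then have eq: "v - u = \<bar>w - v\<bar> + \<bar>u - w\<bar>" using uv(3) by arith
      have "[v - u = b + a] (mod 2 * k)" unfolding eq by (rule cong_add[OF b(2) a(2)])
      moreover have "b + a \<in> step_residues c"
        using a(1) b(1) unfolding step_residues_def insert_iff by (smt (verit))
      ultimately show ?thesis by (rule bexI)
    next
      case 3
      then have eq: "v - u = \<bar>u - w\<bar> - \<bar>w - v\<bar>" using uv(3) by arith
      have "[v - u = a - b] (mod 2 * k)" unfolding eq by (rule cong_diff[OF a(2) b(2)])
      moreover have "a - b \<in> step_residues c"
        using a(1) b(1) unfolding step_residues_def insert_iff by (smt (verit))
      ultimately show ?thesis by (rule bexI)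
    qed
  qed
qed

text \<open>The listed residues are above \<open>- 2 * k\<close> and at most \<open>2 * k\<close>,
  so a representative strictly between 0 and \<open>2 * k\<close> is the residue itself or its shift
  by \<open>2 * k\<close>.\<close>

lemma step_residues_lift:
  assumes "1 \<le> c" "c \<le> k" "0 < p" "p < 2 * k" "\<exists>a\<in>step_residues c. [p = a] (mod 2 * k)"
  shows "p \<in> {c, 2 * k + 1 - c, 1, 2 * c, 2 * k + 2 - 2 * c, 2 * c - 1, 2 * k + 1 - 2 * c}"
proof -
  obtain a where a: "a \<in> step_residues c" "[p = a] (mod 2 * k)" using assms by blast
  obtain q where q: "p = a + 2 * k * q" using a(2) by (metis cong_iff_lin cong_sym)
  have ab: "a \<le> 2 * k" "a > - 2 * k" using a(1) assms by (auto simp: step_residues_def)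
  have "q < 2"
  proof (rule ccontr)
    assume "\<not> q < 2" then have "2 * k * 2 \<le> 2 * k * q" using assms by (intro mult_left_mono) auto
    then show False using q ab assms by linarith
  qed
  moreover have "q > -1"
  proof (rule ccontr)
    assume "\<not> q > -1" then have "2 * k * q \<le> 2 * k * (-1)" using assms by (intro mult_left_mono) auto
    then show False using q ab assms by linarith
  qed
  ultimately have "p = a \<or> p = a + 2 * k" using q by (cases "q = 0"; cases "q = 1") auto
  then show ?thesis using a(1) assms(1-4) unfolding step_residues_def insert_iff empty_iff
    by (smt (verit))
qed

text \<open>Here a residue and its negative are both allowed. This always holds for 2c - 1, and it
  holds for \<open>k\<close>, its own negative, as soon as \<open>k\<close> is allowed. Any other
  pair comes from c + (2 - 2c) or 1 + (1 - c), forcing \<open>c = 2\<close>, or from c + 2c or (1 -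
  c) + (2 - 2c), forcing one of the equations for \<open>3 * c\<close>.\<close>

lemma two_way_residue:
  fixes c k p :: int
  assumes "1 \<le> c" "c \<le> k" "c \<noteq> 2" "3 * c \<noteq> 2 * k" "3 * c \<noteq> 2 * k + 3" "k \<ge> 4"
    and "0 < p" "p < 2 * k"
    and "p \<in> {c, 2 * k + 1 - c, 1, 2 * c, 2 * k + 2 - 2 * c, 2 * c - 1, 2 * k + 1 - 2 * c}"
    and "2 * k - p \<in> {c, 2 * k + 1 - c, 1, 2 * c, 2 * k + 2 - 2 * c, 2 * c - 1, 2 * k + 1 - 2 * c}"
  shows "p = 2 * c - 1 \<or> p = 2 * k + 1 - 2 * c \<or>
     p = k \<and> (c = k \<or> 2 * c = k \<or> 2 * c = k + 2)"
  using assms unfolding insert_iff empty_iff by (smt (z3))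

text \<open>Put x = 2c - 1. The candidates are x, -x and k modulo 2k. A triple would make x or 3x
  vanish, impossible since both are odd, or give 2x = k; but whenever k is a candidate, 2x is 2 or
  -2 modulo 2k, and \<open>k \<ge> 4\<close>.\<close>

lemma two_way_residue_no_triple:
  fixes c k p q :: int
  defines "two_way \<equiv> \<lambda>d. d = 2 * c - 1 \<or> d = 2 * k + 1 - 2 * c \<or>
     d = k \<and> (c = k \<or> 2 * c = k \<or> 2 * c = k + 2)"
  assumes "1 \<le> c" "c \<le> k" "k \<ge> 4" "0 < p" "p < q" "q < 2 * k"
    and "two_way p" "two_way q" "two_way (q - p)"
  shows False
  using assms(2-) unfolding two_way_def by (smt (z3))

section \<open>Counting by hulls of residue classes\<close>

lemma card_le_hull:
  fixes X :: "int set"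
  assumes "finite X" "X \<noteq> {}" "m > 0" "\<forall>x\<in>X. x mod m = r"
  shows "m * int (card X) \<le> Max X - Min X + m"
proof -
  define f where "f x = (x - Min X) div m" for x
  have dv: "m dvd x - Min X" if "x \<in> X" for x
    using assms that by (metis Min_in mod_eq_dvd_iff)
  have eq: "x = Min X + m * f x" if "x \<in> X" for x
    using dv[OF that] by (simp add: f_def)
  have "inj_on f X" using eq by (metis inj_onI)
  moreover have "f ` X \<subseteq> {0..f (Max X)}"
    using assms by (auto simp: f_def zdiv_mono1 pos_imp_zdiv_nonneg_iff)
  ultimately have "card X \<le> card {0..f (Max X)}"
    by (meson card_inj_on_le finite_atLeastAtMost_int)
  moreover have "f (Max X) \<ge> 0" using assms by (auto simp: f_def pos_imp_zdiv_nonneg_iff)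
  ultimately have "int (card X) \<le> f (Max X) + 1" by simp
  then have "m * int (card X) \<le> m * (f (Max X) + 1)" using assms by (intro mult_left_mono) auto
  then show ?thesis using eq[of "Max X"] assms by (simp add: algebra_simps)
qed

lemma card_le_2I:
  fixes S :: "'a::linorder set"
  assumes "\<And>a b c. \<lbrakk>a \<in> S; b \<in> S; c \<in> S; a < b; b < c\<rbrakk> \<Longrightarrow> False"
  shows "card S \<le> 2"
proof (rule ccontr)
  assume "\<not> card S \<le> 2"
  then obtain T where T: "T \<subseteq> S" "card T = 3" by (metis obtain_subset_with_card_n not_less_eq_eq numeral_3_eq_3 numeral_2_eq_2)
  then obtain x y z where "T = {x, y, z}" "x \<noteq> y" "x \<noteq> z" "y \<noteq> z" by (metis card_3_iff)
  then show False using T assms by (metis insert_subset linorder_neqE)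
qed

lemma card_two_step_le:
  fixes k c N :: int
  assumes c: "1 \<le> c" "c \<le> k" "c \<noteq> 2" "3 * c \<noteq> 2 * k" "3 * c \<noteq> 2 * k + 3" and k: "k \<ge> 4"
    and H: "H \<subseteq> {0..2 * k * s}" "two_step k c H" and s: "s \<ge> 1"
  shows "int (card H) \<le> 2 * s + 7"
proof (cases "card H \<le> 1")
  case True
  then show ?thesis using s by linarith
next
  case False
  define K where "K = 2 * k"
  have K: "K \<ge> 8" using k by (simp add: K_def)
  have fin: "finite H" using H finite_subset by blast
  have ne: "H \<noteq> {}" using False by auto
  define u where "u = Min H"
  have u: "u \<in> H" "\<And>x. x \<in> H \<Longrightarrow> u \<le> x" using fin ne by (auto simp: u_def)
  define R where "R = (\<lambda>x. x mod K) ` H"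
  define cls where "cls r = {x \<in> H. x mod K = r}" for r
  have finR: "finite R" using fin by (simp add: R_def)
  have fincls: "finite (cls r)" for r using fin by (simp add: cls_def)
  have necls: "cls r \<noteq> {}" if "r \<in> R" for r using that by (auto simp: cls_def R_def)
  have res: "\<exists>a\<in>step_residues c. [v - w = a] (mod K)" if "w \<in> H" "v \<in> H" "w < v" for v w
    using two_step_residue[OF _ H(2) that] k by (simp add: K_def)
  have "R \<subseteq> (\<lambda>a. (u + a) mod K) ` step_residues c"
  proof
    fix r assume "r \<in> R"
    then obtain x where x: "x \<in> H" "r = x mod K" by (auto simp: R_def)
    have "\<exists>a\<in>step_residues c. [x - u = a] (mod K)"
    proof (cases "x = u")
      case True
      then show ?thesis by (intro bexI[of _ 0]) (auto simp: step_residues_def)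
    next
      case False
      then show ?thesis using res[OF u(1) x(1)] u(2)[OF x(1)] by simp
    qed
    then obtain a where a: "a \<in> step_residues c" "[x - u = a] (mod K)" by blast
    have "[u + (x - u) = u + a] (mod K)" using a(2) by (intro cong_add) auto
    then show "r \<in> (\<lambda>a. (u + a) mod K) ` step_residues c" using a(1) x(2) by (auto simp: cong_def)
  qed
  then have "card R \<le> card (step_residues c)"
    by (meson card_image_le card_mono finite_imageI le_trans finite.intros step_residues_def finite_step_residues)
  also have "\<dots> \<le> 8" unfolding step_residues_def by (simp add: card_insert_le_m1)
  finally have R8: "card R \<le> 8" .
  define lo where "lo r = Min (cls r)" for r
  define hi where "hi r = Max (cls r)" for r
  have lohi: "lo r \<in> H" "lo r mod K = r" "hi r \<in> H" "hi r mod K = r" if "r \<in> R" for r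
    using Min_in[OF fincls necls[OF that]] Max_in[OF fincls necls[OF that]]
    by (auto simp: lo_def hi_def cls_def)
  have lolehi: "lo r \<le> hi r" if "r \<in> R" for r
    using fincls necls[OF that] by (simp add: lo_def hi_def)
  \<comment> \<open>Hulls are taken half-open, so that \<open>hi r - lo r\<close> is the number of
    points in the hull of \<open>r\<close>.\<close>
  define cov where "cov y = {r \<in> R. lo r \<le> y \<and> y < hi r}" for y
  have cov2: "card (cov y) \<le> 2" for y
  proof (rule card_le_2I)
    fix a b d assume abd: "a \<in> cov y" "b \<in> cov y" "d \<in> cov y" "a < b" "b < d"
    define two_way where "two_way \<equiv> \<lambda>d. d = 2 * c - 1 \<or> d = 2 * k + 1 - 2 * c \<or>
       d = k \<and> (c = k \<or> 2 * c = k \<or> 2 * c = k + 2)"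
    have inR: "0 \<le> r" "r < K" if "r \<in> R" for r using that K by (auto simp: R_def)
    \<comment> \<open>Since both hulls contain \<open>y\<close>,
      \<open>lo r \<le> y < hi r'\<close>. The roles of \<open>r\<close> and \<open>r'\<close> can
      be exchanged, so the difference is allowed in both directions.\<close>
    have fwd: "\<exists>e\<in>step_residues c. [r' - r = e] (mod K)" if "r \<in> cov y" "r' \<in> cov y" for r r'
    proof -
      have R: "r \<in> R" "r' \<in> R" and lt: "lo r < hi r'" using that by (auto simp: cov_def)
      have "[hi r' - lo r = r' - r] (mod K)"
        using lohi[OF R(1)] lohi[OF R(2)] inR[OF R(1)] inR[OF R(2)]
        by (intro cong_diff) (auto simp: cong_def)
      then show ?thesis using res[OF lohi(1)[OF R(1)] lohi(3)[OF R(2)] lt]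
        by (meson cong_sym cong_trans)
    qed
    have tw: "two_way (r' - r)" if r: "r \<in> cov y" "r' \<in> cov y" "r < r'" for r r'
    proof -
      have R: "r \<in> R" "r' \<in> R" using r by (auto simp: cov_def)
      have b: "0 < r' - r" "r' - r < 2 * k" using inR[OF R(1)] inR[OF R(2)] r(3) by (auto simp: K_def)
      obtain e where e: "e \<in> step_residues c" "[r - r' = e] (mod K)" using fwd[OF r(2,1)] by blast
      have "[2 * k - (r' - r) = r - r'] (mod K)" by (simp add: cong_iff_dvd_diff K_def)
      then have "\<exists>a\<in>step_residues c. [2 * k - (r' - r) = a] (mod 2 * k)"
        using e cong_trans unfolding K_def by blast
      then show ?thesis unfolding two_way_def
        using two_way_residue[OF c k b step_residues_lift[OF c(1,2) b]]
          step_residues_lift[OF c(1,2), of "2 * k - (r' - r)"] fwd[OF r(1,2)] b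
        by (simp add: K_def)
    qed
    have "two_way (b - a)" "two_way (d - a)" "two_way ((d - a) - (b - a))"
      using tw[of a b] tw[of a d] tw[of b d] abd by auto
    moreover have "0 < b - a" "b - a < d - a" "d - a < 2 * k"
      using abd inR[of a] inR[of d] by (auto simp: K_def cov_def)
    ultimately show False
      using two_way_residue_no_triple[OF c(1,2) k] unfolding two_way_def by blast
  qed
  \<comment> \<open>The least vertex lies in no hull but that of its own class, since
    \<open>lo r \<le> u\<close> forces \<open>lo r = u\<close>. This saves the unit that makes the
    final inequality strict.\<close>
  have cov1: "card (cov u) \<le> 1"
  proof -
    have "r = u mod K" if "r \<in> cov u" for r
      using that lohi[of r] u(2)[of "lo r"] by (auto simp: cov_def)
    then have "cov u \<subseteq> {u mod K}" by auto
    then have "card (cov u) \<le> card {u mod K}" by (intro card_mono) simp_all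
    then show ?thesis by simp
  qed
  have uN: "u \<in> {0..<K * s}"
  proof -
    have "u \<noteq> K * s"
    proof
      assume "u = K * s"
      then have "H \<subseteq> {u}" using u H(1) by (force simp: K_def)
      then show False using False card_mono[of "{u}" H] by simp
    qed
    then show ?thesis using u(1) H(1) by (force simp: K_def)
  qed
  \<comment> \<open>Double counting of the pairs of a class and a point of its hull.\<close>
  have "(\<Sum>r\<in>R. hi r - lo r) = (\<Sum>r\<in>R. \<Sum>y\<in>{0..<K * s}. if lo r \<le> y \<and> y < hi r then 1 else 0)"
  proof (rule sum.cong[OF refl])
    fix r assume r: "r \<in> R"
    have "{y \<in> {0..<K * s}. lo r \<le> y \<and> y < hi r} = {lo r..<hi r}"
      using lohi[OF r] H(1) by (force simp: K_def)
    then have "(\<Sum>y\<in>{0..<K * s}. if lo r \<le> y \<and> y < hi r then 1 else 0) = int (card {lo r..<hi r})"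
      by (subst sum.inter_filter[symmetric]) auto
    then show "hi r - lo r = (\<Sum>y\<in>{0..<K * s}. if lo r \<le> y \<and> y < hi r then 1 else 0)"
      using lolehi[OF r] by simp
  qed
  also have "\<dots> = (\<Sum>y\<in>{0..<K * s}. \<Sum>r\<in>R. if lo r \<le> y \<and> y < hi r then 1 else 0)"
    by (rule sum.swap)
  also have "\<dots> = (\<Sum>y\<in>{0..<K * s}. int (card (cov y)))"
    using finR by (intro sum.cong refl, subst sum.inter_filter[symmetric]) (auto simp: cov_def)
  also have "\<dots> = int (card (cov u)) + (\<Sum>y\<in>{0..<K * s} - {u}. int (card (cov y)))"
    using uN by (subst sum.remove[of _ u]) auto
  also have "\<dots> \<le> 1 + (\<Sum>y\<in>{0..<K * s} - {u}. 2)"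
    using cov1 cov2 by (intro add_mono sum_mono) (auto simp: numeral_le_iff of_nat_le_iff)
  also have "\<dots> = 1 + 2 * int (card ({0..<K * s} - {u}))" by simp
  also have "card ({0..<K * s} - {u}) = nat (K * s) - 1" using uN by simp
  also have "1 + 2 * int (nat (K * s) - 1) = 2 * K * s - 1" using uN by auto
  finally have len: "(\<Sum>r\<in>R. hi r - lo r) \<le> 2 * K * s - 1" .
  have "(\<Union>r\<in>R. cls r) = H" by (auto simp: R_def cls_def)
  moreover have "card (\<Union>r\<in>R. cls r) = (\<Sum>r\<in>R. card (cls r))"
    using finR fincls by (intro card_UN_disjoint) (auto simp: cls_def)
  ultimately have "card H = (\<Sum>r\<in>R. card (cls r))" by simp
  then have "K * int (card H) = (\<Sum>r\<in>R. K * int (card (cls r)))" by (simp add: sum_distrib_left)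
  also have "\<dots> \<le> (\<Sum>r\<in>R. (hi r - lo r) + K)"
    using card_le_hull[OF fincls necls, of _ K] K
    by (intro sum_mono) (auto simp: lo_def hi_def cls_def)
  also have "\<dots> = (\<Sum>r\<in>R. hi r - lo r) + K * int (card R)" by (simp add: sum.distrib)
  also have "\<dots> \<le> (2 * K * s - 1) + K * 8"
    using len R8 K by (intro add_mono mult_left_mono) auto
  also have "\<dots> < K * (2 * s + 8)" by (simp add: algebra_simps)
  finally show ?thesis using K by simp
qed

text \<open>For class 2 both 1 and -1 are allowed, so the argument on overlapping hulls fails.
  Instead all allowed residues lie in \<open>{-3..4}\<close>, so \<open>H\<close> is confined to at
  most \<open>s + 1\<close> short windows, one per period \<open>2 * k\<close>. Each holds two
  vertices, except that one may hold three.\<close>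

lemma card_two_step_class_2_le:
  fixes k s :: int
  assumes k: "k \<ge> 6" and H: "H \<subseteq> {0..2 * k * s}" "two_step k 2 H" and s: "s \<ge> 1"
  shows "int (card H) \<le> 2 * s + 3"
proof (cases "H = {}")
  case True
  then show ?thesis using s by simp
next
  case ne: False
  define K where "K = 2 * k"
  have K: "K \<ge> 12" using k by (simp add: K_def)
  have fin: "finite H" using H finite_subset by blast
  define u where "u = Min H"
  have u: "u \<in> H" "\<And>x. x \<in> H \<Longrightarrow> u \<le> x" using fin ne by (auto simp: u_def)
  have diff: "\<exists>a\<in>{-3..4}. K dvd (v - w) - a" if vw: "w \<in> H" "v \<in> H" "w < v" for v w
  proof -
    have "step_residues 2 \<subseteq> {-3..4}" by (simp add: step_residues_def)
    moreover obtain a where "a \<in> step_residues 2" "[v - w = a] (mod K)"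
      using two_step_residue[OF _ H(2) vw] k by (auto simp: K_def)
    ultimately show ?thesis by (auto simp: cong_iff_dvd_diff)
  qed
  have small: False if "K dvd d" "0 < d" "d < K" for d
    using zdvd_imp_le[OF that(1,2)] that(3) by simp
  \<comment> \<open>The distances to a common neighbour would be consecutive integers, each 2 or -1
    modulo \<open>K\<close>. Then 1 would be congruent to 0, 3 or -3, and \<open>K\<close> would
    divide 1, 2 or 4.\<close>
  have no_consecutive: "x + 1 \<notin> H" if x: "x \<in> H" for x
  proof
    assume x1: "x + 1 \<in> H"
    have f1: "fold_class k 1 \<noteq> 2" using k by (simp add: fold_class_def)
    obtain w where w: "fold_class k \<bar>x - w\<bar> = 2" "fold_class k \<bar>w - (x + 1)\<bar> = 2"
      using H(2)[unfolded two_step_def, THEN bspec, OF x, THEN bspec, OF x1] f1 by auto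
    have f2: "False" if d: "fold_class k d = 2" "fold_class k (d + 1) = 2" for d
    proof -
      have A: "K dvd d - 2 \<or> K dvd d - (1 - 2)" "K dvd (d + 1) - 2 \<or> K dvd (d + 1) - (1 - 2)"
        using fold_class_cong[OF _ d(1)] fold_class_cong[OF _ d(2)] k
        unfolding cong_iff_dvd_diff K_def by simp_all
      have "K dvd 1 \<or> K dvd 4 \<or> K dvd 2"
        using A dvd_diff[of K "d + 1 - 2" "d - 2"] dvd_diff[of K "d + 1 - (1 - 2)" "d - 2"]
          dvd_diff[of K "d - (1 - 2)" "d + 1 - 2"] dvd_diff[of K "d + 1 - (1 - 2)" "d - (1 - 2)"]
        by auto
      then show False using small[of 1] small[of 2] small[of 4] K by auto
    qed
    show False
    proof (cases "w \<le> x")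
      case True
      then have "\<bar>x - w\<bar> = x - w" "\<bar>w - (x + 1)\<bar> = x - w + 1" by auto
      then show False using w f2[of "x - w"] by metis
    next
      case False
      then have "\<bar>x - w\<bar> = w - (x + 1) + 1" "\<bar>w - (x + 1)\<bar> = w - (x + 1)" by auto
      then show False using w f2[of "w - (x + 1)"] by metis
    qed
  qed
  \<comment> \<open>The shift by 3 keeps the offsets from -3 to 4 around a multiple of
    \<open>K\<close> within one period.\<close>
  define t where "t x = (x - u + 3) div K" for x
  define b where "b x = (x - u + 3) mod K - 3" for x
  have dec: "x = u + K * t x + b x" for x
    using mult_div_mod_eq[of K "x - u + 3"] unfolding t_def b_def by linarith
  have b_range: "b x \<in> {-3..4}" if x: "x \<in> H" for x
  proof (cases "x = u")
    case True
    then show ?thesis using K by (simp add: b_def)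
  next
    case False
    then obtain a where a: "a \<in> {-3..4}" "K dvd (x - u) - a" using diff[OF u(1) x] u(2)[OF x] by auto
    then have "(x - u + 3) mod K = (a + 3) mod K" by (simp add: mod_eq_dvd_iff)
    also have "\<dots> = a + 3" using a K by simp
    finally show ?thesis using a by (simp add: b_def)
  qed
  have t_range: "t x \<in> {0..s}" if x: "x \<in> H" for x
  proof -
    have "0 \<le> x - u + 3" using u(2)[OF x] by simp
    then have t0: "0 \<le> t x" unfolding t_def using K by (simp add: pos_imp_zdiv_nonneg_iff)
    have "x \<le> K * s" "0 \<le> u"
      using subsetD[OF H(1) x] subsetD[OF H(1) u(1)] by (simp_all add: K_def)
    then have "x - u + 3 < K * (s + 1)" using K by (simp add: algebra_simps)
    moreover have "K * t x \<le> x - u + 3"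
      using dec[of x] pos_mod_sign[of K "x - u + 3"] K unfolding b_def by linarith
    ultimately have "K * t x < K * (s + 1)" by linarith
    then show ?thesis using K t0 by simp
  qed
  have dvd_b: "K dvd (y - x) - (b y - b x)" for x y
  proof -
    have "(y - x) - (b y - b x) = K * (t y - t x)"
      using dec[of x] dec[of y] by (simp add: right_diff_distrib)
    then show ?thesis by simp
  qed
  \<comment> \<open>If \<open>y\<close> came first, \<open>x - y\<close> would be congruent to some
    \<open>a\<close> with \<open>b y - b x + a\<close> between 1 and 11 and divisible by
    \<open>K\<close>. Here \<open>k \<ge> 6\<close> enters.\<close>
  have b_before: "x < y" if xy: "x \<in> H" "y \<in> H" "b y - b x \<ge> 4" for x y
  proof (rule ccontr)
    assume "\<not> x < y"
    moreover have "x \<noteq> y" using xy by auto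
    ultimately have "y < x" by simp
    then obtain a where a: "a \<in> {-3..4}" "K dvd (x - y) - a" using diff[OF xy(2,1)] by blast
    have "K dvd - (((y - x) - (b y - b x)) + ((x - y) - a))"
      using dvd_add[OF dvd_b a(2)] by (simp only: dvd_minus_iff)
    then have "K dvd (b y - b x) + a" by (simp add: algebra_simps)
    moreover have "b y - b x \<le> 7" using b_range[OF xy(1)] b_range[OF xy(2)] by simp
    ultimately show False using small[of "b y - b x + a"] a(1) xy(3) K by auto
  qed
  \<comment> \<open>A larger gap would, by \<open>b_before\<close>, put \<open>x\<close> before
    \<open>y\<close>, and then \<open>y - x\<close> would be congruent to an allowed residue, which
    is at most 4.\<close>
  have b_gap: "b y - b x \<le> 4" if xy: "x \<in> H" "y \<in> H" for x y
  proof (rule ccontr)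
    assume g: "\<not> b y - b x \<le> 4"
    then obtain a where a: "a \<in> {-3..4}" "K dvd (y - x) - a"
      using diff[OF xy] b_before[OF xy] by auto
    have "K dvd ((y - x) - a) - ((y - x) - (b y - b x))" by (rule dvd_diff[OF a(2) dvd_b])
    then have "K dvd (b y - b x) - a" by (simp add: algebra_simps)
    moreover have "b y - b x \<le> 7" using b_range[OF xy(1)] b_range[OF xy(2)] by simp
    ultimately show False using small[of "b y - b x - a"] g a(1) K by auto
  qed
  define m where "m = Min (b ` H)"
  have m: "m \<in> b ` H" "\<And>x. x \<in> H \<Longrightarrow> m \<le> b x" using fin ne by (auto simp: m_def)
  have bm: "b x - m \<in> {0..4}" if "x \<in> H" for x using m b_gap[OF _ that] that by fastforce
  define L where "L = {x \<in> H. b x = m}"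
  have L: "finite L" "L \<noteq> {}" using fin m(1) by (auto simp: L_def)
  \<comment> \<open>The last period with a vertex of least offset.\<close>
  define \<tau> where "\<tau> = Max (t ` L)"
  have "\<tau> \<in> t ` L" unfolding \<tau>_def using L by (intro Max_in) simp_all
  then obtain z where z: "z \<in> L" "t z = \<tau>" by blast
  \<comment> \<open>The offsets \<open>b x - m\<close> lie in \<open>{0..4}\<close> and those in one period are never consecutive. All
    offsets \<open>0\<close> precede all offsets \<open>4\<close>, so only the period \<open>\<tau>\<close> can hold three of them.\<close>
  define slot where "slot x = (if t x \<le> \<tau> then (b x - m) div 2 else (b x - m - 1) div 2)" for x
  have key: "(t x, slot x) \<in> {0..s} \<times> {0, 1} \<union> {(\<tau>, 2)}" if x: "x \<in> H" for x
  proof -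
    have last: "\<tau> \<le> t x" if "b x - m = 4"
    proof (rule ccontr)
      assume "\<not> \<tau> \<le> t x"
      then have "K * t x + K \<le> K * \<tau>" using K mult_left_mono[of "t x + 1" \<tau> K] by (simp add: algebra_simps)
      moreover have "z < x" using b_before[of z x] z x that by (simp add: L_def)
      ultimately show False using dec[of z] dec[of x] z that K by (simp add: L_def)
    qed
    have first: "t x \<le> \<tau>" if "b x = m"
      using x that L by (auto simp: \<tau>_def L_def)
    have y: "0 \<le> b x - m" "b x - m \<le> 4" using bm[OF x] by auto
    have "slot x = 0 \<or> slot x = 1 \<or> t x = \<tau> \<and> slot x = 2"
    proof (cases "t x \<le> \<tau>")
      case True
      have "(b x - m) div 2 = 0 \<or> (b x - m) div 2 = 1 \<or> b x - m = 4" using y by presburger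
      then show ?thesis using True last by (auto simp: slot_def)
    next
      case False
      then have "b x \<noteq> m" using first by blast
      then have "(b x - m - 1) div 2 = 0 \<or> (b x - m - 1) div 2 = 1" using y by presburger
      then show ?thesis using False by (auto simp: slot_def)
    qed
    then show ?thesis using t_range[OF x] by auto
  qed
  have "inj_on (\<lambda>x. (t x, slot x)) H"
  proof (rule inj_onI)
    fix x y assume xy: "x \<in> H" "y \<in> H" "(t x, slot x) = (t y, slot y)"
    \<comment> \<open>Equal periods use the same branch of \<open>slot\<close>, and halving
      identifies only adjacent offsets.\<close>
    then have "b x - b y \<in> {-1, 0, 1}" unfolding slot_def by (auto split: if_splits)
    moreover have "x - y = b x - b y" using dec[of x] dec[of y] xy(3) by simp
    ultimately have "x = y \<or> x = y + 1 \<or> y = x + 1" by auto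
    then show "x = y" using no_consecutive xy by blast
  qed
  then have "card H \<le> card ({0..s} \<times> {0, 1 :: int} \<union> {(\<tau>, 2)})"
    by (rule card_inj_on_le) (use key in blast, simp)
  also have "\<dots> \<le> card ({0..s} \<times> {0, 1 :: int}) + card {(\<tau>, 2 :: int)}" by (rule card_Un_le)
  also have "\<dots> = 2 * nat (s + 1) + 1" by (simp add: card_cartesian_product)
  finally show ?thesis using s by linarith
qed

section \<open>Transport of the bounds by multiplication modulo n\<close>

section \<open>Dilations\<close>

lemma fold_class_minus_mod:
  assumes "k \<ge> 1" "n = 2 * k * s + 1" "s \<ge> 1"
  shows "fold_class k ((- a) mod n) = fold_class k (a mod n)"
proof (cases "a mod n = 0")
  case True
  then show ?thesis by (simp add: zmod_zminus1_eq_if)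
next
  case False
  then have "(- a) mod n = n - a mod n" by (simp add: zmod_zminus1_eq_if)
  moreover have "[n - a mod n = 1 - a mod n] (mod 2 * k)"
    using assms by (simp add: cong_iff_dvd_diff)
  ultimately show ?thesis
    using fold_class_cong_mod fold_class_reflect[OF assms(1)] by metis
qed

text \<open>The classes covered by \<open>card_two_step_le\<close> or
  \<open>card_two_step_class_2_le\<close>.\<close>

definition good_class :: "int \<Rightarrow> int \<Rightarrow> bool" where
  "good_class k c \<longleftrightarrow> 1 \<le> c \<and> c \<le> k \<and> 3 * c \<noteq> 2 * k \<and> 3 * c \<noteq> 2 * k + 3 \<and> (c = 2 \<longrightarrow> k \<ge> 6)"

text \<open>Multiplication by the unit \<open>e\<close> is injective modulo \<open>n\<close> and
  sends related vertices to residues at a distance of class \<open>c\<close>: this distance is the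
  residue of their difference or of its negative, which have the same class. So the image of
  \<open>H\<close> is a \<open>two_step\<close> set of the same size.\<close>

lemma card_diameter_two_le:
  fixes k s n :: int and E :: "int \<Rightarrow> int \<Rightarrow> bool"
  assumes k: "k \<ge> 4" and s: "s \<ge> 1" and n: "n = 2 * k * s + 1"
    and e: "coprime e n" and c: "good_class k c"
    and E: "\<And>x y. E x y \<Longrightarrow> fold_class k ((e * (x - y)) mod n) = c"
    and H: "H \<subseteq> {0..<n}"
      "\<forall>x\<in>H. \<forall>y\<in>H. x \<noteq> y \<longrightarrow> E x y \<or> (\<exists>w\<in>H. E x w \<and> E w y)"
  shows "int (card H) \<le> 2 * s + 7"
proof -
  define f where "f x = (e * x) mod n" for x
  have npos: "n > 0" using n k s by (simp add: add_pos_pos)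
  have class_f: "fold_class k \<bar>f x - f y\<bar> = c" if "E x y" for x y
  proof -
    have f: "f x \<in> {0..<n}" "f y \<in> {0..<n}" using npos by (auto simp: f_def)
    have "(e * (x - y)) mod n = (f x - f y) mod n"
      by (simp add: f_def right_diff_distrib mod_diff_eq)
    then have c1: "fold_class k ((f x - f y) mod n) = c" using E[OF that] by simp
    moreover have "fold_class k ((f y - f x) mod n) = c"
      using c1 fold_class_minus_mod[of k n s "f x - f y"] k n s by simp
    ultimately show ?thesis using f by (cases "f y \<le> f x") auto
  qed
  have inj: "inj_on f H"
  proof (rule inj_onI)
    fix x y assume xy: "x \<in> H" "y \<in> H" "f x = f y"
    then have "[e * x = e * y] (mod n)" by (simp add: f_def cong_def)
    then have "[x = y] (mod n)" using e by (simp add: cong_mult_lcancel)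
    then show "x = y" using xy H(1) by (auto simp: cong_def subset_iff)
  qed
  have two: "two_step k c (f ` H)"
    unfolding two_step_def
  proof (intro ballI impI)
    fix u v assume "u \<in> f ` H" "v \<in> f ` H" "u \<noteq> v"
    then obtain x y where xy: "x \<in> H" "y \<in> H" "x \<noteq> y" "u = f x" "v = f y" by auto
    then have "E x y \<or> (\<exists>w\<in>H. E x w \<and> E w y)" using H(2) by blast
    then show "fold_class k \<bar>u - v\<bar> = c \<or>
        (\<exists>w\<in>f ` H. fold_class k \<bar>u - w\<bar> = c \<and> fold_class k \<bar>w - v\<bar> = c)"
      using class_f xy by blast
  qed
  have "f ` H \<subseteq> {0..2 * k * s}"
  proof
    fix u assume "u \<in> f ` H"
    then have "0 \<le> u" "u < n" using npos by (auto simp: f_def)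
    then show "u \<in> {0..2 * k * s}" using n by simp
  qed
  then have "int (card (f ` H)) \<le> 2 * s + 7"
    using card_two_step_le[OF _ _ _ _ _ k _ two s] card_two_step_class_2_le[of k "f ` H" s] two s c
    unfolding good_class_def by (cases "c = 2") force+
  then show ?thesis using inj by (simp add: card_image)
qed

section \<open>Labellings of the distances\<close>

lemma fold_class_cases:
  assumes "k \<ge> 1" "1 \<le> c" "c \<le> k"
  shows "fold_class k x = c \<longleftrightarrow> 2 * k dvd x - c \<or> 2 * k dvd x - (1 - c)"
proof
  assume "fold_class k x = c"
  then show "2 * k dvd x - c \<or> 2 * k dvd x - (1 - c)"
    using fold_class_cong[OF assms(1), of x c] by (simp add: cong_iff_dvd_diff)
next
  assume "2 * k dvd x - c \<or> 2 * k dvd x - (1 - c)"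
  then have "fold_class k x = fold_class k c \<or> fold_class k x = fold_class k (1 - c)"
    using fold_class_cong_mod by (auto simp: cong_iff_dvd_diff)
  then show "fold_class k x = c" using assms by (auto simp: fold_class_reflect fold_class_eq_self)
qed

text \<open>The second conjunct keeps the blocks of the later partition nonempty; the third lets
  each label have its own dilation \<open>e\<close> into a good class.\<close>

definition good_labelling :: "int \<Rightarrow> int \<Rightarrow> (int \<Rightarrow> int) \<Rightarrow> bool" where
  "good_labelling k n lab \<longleftrightarrow>
     (\<forall>d\<in>{1..<n}. lab d \<in> {1..k} \<and> lab (n - d) = lab d) \<and>
     (\<forall>i\<in>{1..k}. \<exists>d\<in>{1..<n}. lab d = i) \<and>
     (\<forall>i\<in>{1..k}. \<exists>e c. coprime e n \<and> good_class k c \<and>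
        (\<forall>d\<in>{1..<n}. lab d = i \<longrightarrow> fold_class k ((e * d) mod n) = c))"

lemma fold_class_reflect_modulus:
  assumes "k \<ge> 1" "n = 2 * k * s + 1"
  shows "fold_class k (n - d) = fold_class k d"
proof -
  have "[n - d = 1 - d] (mod 2 * k)" using assms by (simp add: cong_iff_dvd_diff)
  then show ?thesis using fold_class_cong_mod fold_class_reflect[OF assms(1)] by metis
qed

text \<open>Classes 1 and k together are the residues 0, 1, k and k + 1 modulo 2k, that is, 0 and 1
  modulo k.\<close>

lemma fold_class_1_or_top:
  assumes "k \<ge> 1" "k dvd m \<or> k dvd m - 1"
  shows "fold_class k m = 1 \<or> fold_class k m = k"
proof -
  have two: "2 * k dvd k * q \<or> 2 * k dvd k * q - k" for q
  proof (cases "even q")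
    case True
    then show ?thesis by (auto elim!: evenE)
  next
    case False
    then show ?thesis by (auto elim!: oddE simp: algebra_simps)
  qed
  consider q where "m = k * q" | q where "m - 1 = k * q" using assms(2) by (auto elim!: dvdE)
  then show ?thesis
  proof cases
    case 1
    then show ?thesis using two[of q] fold_class_cases[OF assms(1), of 1 m]
        fold_class_cases[OF assms(1), of k m] assms(1) by auto
  next
    case 2
    then have "2 * k dvd m - 1 \<or> 2 * k dvd m - (1 - k) - 2 * k"
      using two[of q] by (simp add: algebra_simps)
    then have "2 * k dvd m - 1 \<or> 2 * k dvd m - (1 - k)"
      by (metis dvd_diff_commute dvd_diff_right_iff dvd_refl)
    then show ?thesis using fold_class_cases[OF assms(1), of 1 m]
        fold_class_cases[OF assms(1), of k m] assms(1) by auto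
  qed
qed

text \<open>Classes 1 and 2 are the residues -1, 0, 1, 2 modulo 2k. Halving modulo n sends 2m to m
  and 2m + 1 to m + e, where e is 1 modulo k. In both cases the result is 0 or 1 modulo k, so it has
  class 1 or k, and that decides the label.\<close>

lemma ex_good_labelling_not_3_dvd:
  fixes k s n :: int
  assumes k: "k \<ge> 4" and s: "s \<ge> 1" and n: "n = 2 * k * s + 1" and 3: "\<not> 3 dvd k"
  shows "\<exists>lab. good_labelling k n lab"
proof -
  \<comment> \<open>\<open>e\<close> is the inverse of \<open>2\<close> modulo \<open>n\<close>\<close>
  define e where "e = s * k + 1"
  have ks: "k \<le> k * s" using k s by simp
  have nk: "2 * k < n" using n ks k by simp
  have half_even: "(e * (2 * m)) mod n = m" if "0 \<le> m" "m < n" for m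
  proof -
    have "e * (2 * m) = m + n * m" by (simp add: e_def n algebra_simps)
    then show ?thesis using that by simp
  qed
  have half_odd: "(e * (2 * m + 1)) mod n = m + e" if "0 \<le> m" "m + e < n" for m
  proof -
    have "e * (2 * m + 1) = m + e + n * m" by (simp add: e_def n algebra_simps)
    then have "(e * (2 * m + 1)) mod n = (m + e) mod n" by (simp only: mod_mult_self2)
    then show ?thesis using that ks k by (simp add: e_def mult.commute)
  qed
  have half_class: "fold_class k ((e * d) mod n) \<in> {1, k}"
    if d: "d \<in> {1..<n}" "fold_class k d \<in> {1, 2}" for d
  proof -
    have dv: "2 * k dvd d - 1 \<or> 2 * k dvd d \<or> 2 * k dvd d - 2 \<or> 2 * k dvd d + 1"
      using d(2) fold_class_cases[of k 1 d] fold_class_cases[of k 2 d] k by auto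
    have even_of: "even x" if "2 * k dvd x" for x using that by (rule dvd_mult_left)
    have par: "2 * k dvd d \<or> 2 * k dvd d - 2" if "even d"
      using dv that even_of[of "d - 1"] even_of[of "d + 1"] by auto
    have par': "2 * k dvd d - 1 \<or> 2 * k dvd d + 1" if "odd d"
      using dv that even_of[of d] even_of[of "d - 2"] by auto
    have halve: "2 * k dvd 2 * x \<longleftrightarrow> k dvd x" for x by simp
    show ?thesis
    proof (cases "even d")
      case True
      then obtain m where m: "d = 2 * m" by (elim evenE)
      have "k dvd m \<or> k dvd m - 1"
        using par[OF True] halve[of m] halve[of "m - 1"] m by (simp add: right_diff_distrib)
      then show ?thesis using fold_class_1_or_top[of k m] half_even[of m] m d(1) k by auto
    next
      case False
      then obtain m where m: "d = 2 * m + 1" by (elim oddE)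
      have km: "k dvd m \<or> k dvd m + 1"
        using par'[OF False] halve[of m] halve[of "m + 1"] m by (simp add: distrib_left add.commute)
      then have "k dvd m + e \<or> k dvd m + e - 1"
        using dvd_add_left_iff[of k "s * k" m] dvd_add_left_iff[of k "s * k" "m + 1"]
        by (auto simp: e_def algebra_simps)
      \<comment> \<open>Hence 2(m + e) = d + n, which is less than 2n.\<close>
      moreover have "2 * e = n + 1" by (simp add: e_def n)
      then have "m + e < n" using d(1) m unfolding atLeastLessThan_iff by linarith
      ultimately show ?thesis
        using fold_class_1_or_top[of k "m + e"] half_odd[of m] m d(1) k by auto
    qed
  qed
  define lab where "lab d = (if fold_class k d \<in> {1, 2} then
      (if fold_class k ((e * d) mod n) = 1 then 1 else 2) else fold_class k d)" for d
  have cop: "coprime e n"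
  proof (rule coprimeI)
    fix c assume "c dvd e" "c dvd n"
    then have "c dvd 2 * e - n" by simp
    then show "is_unit c" by (simp add: e_def n algebra_simps)
  qed
  have "lab d \<in> {1..k} \<and> lab (n - d) = lab d" for d
  proof
    show "lab d \<in> {1..k}" using fold_class_range[of k d] k unfolding lab_def by auto
    have "(e * (n - d)) mod n = (- (e * d)) mod n"
      by (simp add: right_diff_distrib mod_diff_left_eq [symmetric])
    then show "lab (n - d) = lab d"
      using fold_class_minus_mod[of k n s "e * d"] fold_class_reflect_modulus[of k n s d] k s n
      unfolding lab_def by simp
  qed
  moreover have "\<exists>d\<in>{1..<n}. lab d = i" if i: "i \<in> {1..k}" for i
  proof -
    consider "i = 1" | "i = 2" | "i \<ge> 3" using i by fastforce
    then show ?thesis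
    proof cases
      case 1
      \<comment> \<open>Half of 2 is 1, and half of \<open>2 * k\<close> in the next case is
        \<open>k\<close>: these realise the labels 1 and 2.\<close>
      have "fold_class k 2 = 2" "fold_class k 1 = 1" using k by (simp_all add: fold_class_eq_self)
      then have "lab 2 = 1" using half_even[of 1] nk k by (simp add: lab_def)
      then show ?thesis using 1 nk k by (intro bexI[of _ 2]) auto
    next
      case 2
      have "fold_class k (2 * k) = 1" "fold_class k k = k" using k by (simp_all add: fold_class_def)
      then have "lab (2 * k) = 2" using half_even[of k] nk k by (simp add: lab_def)
      then show ?thesis using 2 nk k by (intro bexI[of _ "2 * k"]) auto
    next
      case 3
      then have "lab i = i" using i by (simp add: lab_def fold_class_eq_self)
      then show ?thesis using i 3 nk by (intro bexI[of _ i]) auto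
    qed
  qed
  moreover have "\<exists>e c. coprime e n \<and> good_class k c \<and>
        (\<forall>d\<in>{1..<n}. lab d = i \<longrightarrow> fold_class k ((e * d) mod n) = c)" if i: "i \<in> {1..k}" for i
  proof -
    \<comment> \<open>Either equation would make 3 divide \<open>2 * k\<close>.\<close>
    have no3: "3 * c \<noteq> 2 * k" "3 * c \<noteq> 2 * k + 3" for c using 3 by presburger+
    have range: "lab d = fold_class k d \<or> lab d \<in> {1, 2}" for d by (simp add: lab_def)
    consider "i = 1" | "i = 2" | "i \<ge> 3" using i by fastforce
    then show ?thesis
    proof cases
      case 1
      have "fold_class k ((e * d) mod n) = 1" if "lab d = 1" for d
        using that by (auto simp: lab_def split: if_splits)
      moreover have "good_class k 1" using k no3 by (auto simp: good_class_def)
      ultimately show ?thesis using cop 1 by blast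
    next
      case 2
      have "fold_class k ((e * d) mod n) = k" if "d \<in> {1..<n}" "lab d = 2" for d
        using that half_class[of d] by (auto simp: lab_def split: if_splits)
      moreover have "good_class k k" using k no3[of k] by (auto simp: good_class_def)
      ultimately show ?thesis using cop 2 by blast
    next
      case 3
      have "fold_class k ((1 * d) mod n) = i" if "d \<in> {1..<n}" "lab d = i" for d
        using that 3 by (auto simp: lab_def split: if_splits)
      moreover have "good_class k i" using i 3 no3[of i] by (auto simp: good_class_def)
      ultimately show ?thesis using coprime_1_left by blast
    qed
  qed
  ultimately show ?thesis unfolding good_labelling_def by blast
qed

text \<open>With k = 3j the bad classes are 2j and 2j + 1; together with class 1 they form the
  residues 0 and 1 modulo 2j. Tripling gives 0 or 3 modulo 2k, and reduction modulo n subtracts qn,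
  congruent to q, with q in {0, 1, 2}. The results have class 1, 2 or 3.\<close>

lemma ex_good_labelling_3_dvd:
  fixes k s n :: int
  assumes k: "k \<ge> 4" and s: "s \<ge> 1" and n: "n = 2 * k * s + 1" and 3: "3 dvd k"
  shows "\<exists>lab. good_labelling k n lab"
proof -
  obtain j where j: "k = 3 * j" using 3 by (elim dvdE)
  \<comment> \<open>So \<open>k \<ge> 6\<close>, as a good class 2 requires.\<close>
  have j2: "j \<ge> 2" using k j by simp
  have ks: "k \<le> k * s" using k s by simp
  have n6: "n > 2 * k" using n ks k by simp
  define J where "J = {1, 2 * j, 2 * j + 1}"
  have JI: "fold_class k d \<in> J" if d: "2 * j dvd d - 1" for d
  proof -
    obtain q where q: "d - 1 = 2 * j * q" using d by (elim dvdE)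
    \<comment> \<open>Modulo 6j, \<open>d\<close> is 1, 2j + 1 or 4j + 1, and the last is congruent
      to 1 - 2j.\<close>
    define p where "p = q div 3"
    have qm: "q = 3 * p \<or> q = 3 * p + 1 \<or> q = 3 * p + 2" unfolding p_def by presburger
    have "d - 1 = 2 * k * p \<or> d - (2 * j + 1) = 2 * k * p \<or> d - (1 - 2 * j) = 2 * k * (p + 1)"
      using qm q by (auto simp: j algebra_simps)
    then have "2 * k dvd d - 1 \<or> 2 * k dvd d - (2 * j + 1) \<or> 2 * k dvd d - (1 - 2 * j)"
      by (metis dvd_triv_left)
    then show ?thesis using fold_class_cases[of k 1 d] fold_class_cases[of k "2 * j" d]
        fold_class_cases[of k "2 * j + 1" d] k j j2 by (auto simp: J_def)
  qed
  have third_class: "fold_class k ((3 * d) mod n) \<in> {1, 2, 3}"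
    if d: "d \<in> {1..<n}" "fold_class k d \<in> J" for d
  proof -
    define q where "q = (3 * d) div n"
    have q: "(3 * d) mod n = 3 * d - n * q" unfolding q_def by (simp add: minus_mult_div_eq_mod)
    have q3: "0 \<le> q" "q < 3"
    proof -
      show "0 \<le> q" unfolding q_def using d(1) by (simp add: pos_imp_zdiv_nonneg_iff)
      have "n * q < n * 3" using q pos_mod_sign[of n "3 * d"] d(1) unfolding atLeastLessThan_iff by linarith
      then show "q < 3" using d(1) mult_less_cancel_left_pos[of n q 3] by simp
    qed
    have dv: "2 * k dvd d - 1 \<or> 2 * k dvd d \<or> 2 * k dvd d - 2 * j \<or> 2 * k dvd d - (1 - 2 * j) \<or>
        2 * k dvd d - (2 * j + 1) \<or> 2 * k dvd d - (- 2 * j)"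
      using d(2) fold_class_cases[of k 1 d] fold_class_cases[of k "2 * j" d]
        fold_class_cases[of k "2 * j + 1" d] k j j2 unfolding J_def by auto
    have jk: "2 * j dvd 2 * k" by (simp add: j)
    have shift: "2 * j dvd x" if "2 * k dvd x + 2 * j * p" for x p
      using dvd_trans[OF jk that] by (simp add: dvd_add_left_iff)
    have "2 * k dvd d \<Longrightarrow> 2 * j dvd d" "2 * k dvd d - 1 \<Longrightarrow> 2 * j dvd d - 1"
      using dvd_trans[OF jk] by blast+
    moreover have "2 * k dvd d - 2 * j \<Longrightarrow> 2 * j dvd d" using shift[of d "-1"] by simp
    moreover have "2 * k dvd d - (- 2 * j) \<Longrightarrow> 2 * j dvd d" using shift[of d 1] by simp
    moreover have "2 * k dvd d - (1 - 2 * j) \<Longrightarrow> 2 * j dvd d - 1"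
      using shift[of "d - 1" 1] by (simp add: algebra_simps)
    moreover have "2 * k dvd d - (2 * j + 1) \<Longrightarrow> 2 * j dvd d - 1"
      using shift[of "d - 1" "-1"] by (simp add: algebra_simps)
    ultimately have "2 * j dvd d \<or> 2 * j dvd d - 1" using dv by blast
    moreover have "2 * k dvd 3 * x \<longleftrightarrow> 2 * j dvd x" for x
      using dvd_times_left_cancel_iff[of 3 "2 * j" x] by (simp add: j)
    ultimately have "2 * k dvd 3 * d \<or> 2 * k dvd 3 * (d - 1)" by blast
    moreover have "2 * k dvd n * q - q" by (simp add: n algebra_simps)
    ultimately have "2 * k dvd 3 * d - (n * q - q) \<or> 2 * k dvd 3 * (d - 1) - (n * q - q)"
      by (meson dvd_diff)
    then have r: "2 * k dvd (3 * d) mod n + q \<or> 2 * k dvd (3 * d) mod n + q - 3"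
      unfolding q by (simp add: algebra_simps)
    consider "q = 0" | "q = 1" | "q = 2" using q3 by linarith
    then show ?thesis
      using r fold_class_cases[of k 1 "(3 * d) mod n"] fold_class_cases[of k 2 "(3 * d) mod n"]
        fold_class_cases[of k 3 "(3 * d) mod n"] k by cases (auto simp: algebra_simps)
  qed
  define lab where "lab d = (if fold_class k d \<in> J then
      (if fold_class k ((3 * d) mod n) = 1 then 1
       else if fold_class k ((3 * d) mod n) = 2 then 2 * j else 2 * j + 1)
      else fold_class k d)" for d
  have self: "fold_class k 1 = 1" "fold_class k 2 = 2" "fold_class k 3 = 3"
    "fold_class k (2 * j) = 2 * j" "fold_class k (2 * k) = 1"
    using k j j2 by (simp_all add: fold_class_eq_self) (simp add: fold_class_def)
  have cop: "coprime 3 n"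
  proof (rule coprimeI)
    fix c assume c: "c dvd 3" "c dvd n"
    have "c dvd 2 * k * s" using c(1) by (metis 3 dvd_mult2 dvd_mult dvd_trans)
    then show "is_unit c" using c(2) n by (simp add: dvd_add_right_iff)
  qed
  have J_range: "x \<in> {1..k}" if "x \<in> J" for x using that j j2 by (auto simp: J_def)
  have "lab d \<in> {1..k} \<and> lab (n - d) = lab d" for d
  proof
    show "lab d \<in> {1..k}"
      using fold_class_range[of k d] k J_range[of 1] J_range[of "2 * j"] J_range[of "2 * j + 1"]
      unfolding lab_def J_def by simp
    have "(3 * (n - d)) mod n = (- (3 * d)) mod n"
      by (simp add: right_diff_distrib mod_diff_left_eq [symmetric])
    then show "lab (n - d) = lab d"
      using fold_class_minus_mod[of k n s "3 * d"] fold_class_reflect_modulus[of k n s d] k s n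
      unfolding lab_def by simp
  qed
  moreover have "\<exists>d\<in>{1..<n}. lab d = i" if i: "i \<in> {1..k}" for i
  proof -
    consider "i = 1" | "i = 2 * j" | "i = 2 * j + 1" | "i \<notin> J" by (auto simp: J_def)
    then show ?thesis
    proof cases
      case 1
      \<comment> \<open>Tripling 2j gives 2k, which has class 1.\<close>
      have "3 * (2 * j) = 2 * k" by (simp add: j)
      then have "lab (2 * j) = 1" unfolding lab_def using self n6 k by (simp only: J_def) simp
      then show ?thesis using 1 n6 j j2 by (intro bexI[of _ "2 * j"]) auto
    next
      case 2
      \<comment> \<open>Chosen so that tripling gives n + 2, which reduces to 2.\<close>
      define d where "d = 2 * j * s + 1"
      have "3 * d = n + 2" by (simp add: d_def n j)
      then have "(3 * d) mod n = 2" using n6 k by simp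
      moreover have "fold_class k d \<in> J" by (rule JI) (simp add: d_def)
      ultimately have "lab d = 2 * j" using self by (simp add: lab_def)
      moreover have "j * s \<ge> 1" using mult_mono[of 1 j 1 s] j2 s by linarith
      then have "d \<in> {1..<n}"
        unfolding d_def n j atLeastLessThan_iff mult.assoc by (intro conjI) linarith+
      ultimately show ?thesis using 2 by blast
    next
      case 3
      have "lab 1 = 2 * j + 1" using self n6 k by (simp add: lab_def J_def)
      then show ?thesis using 3 n6 k by (intro bexI[of _ 1]) auto
    next
      case 4
      then have "lab i = i" using i by (simp add: lab_def fold_class_eq_self)
      then show ?thesis using i n6 by (intro bexI[of _ i]) auto
    qed
  qed
  moreover have "\<exists>e c. coprime e n \<and> good_class k c \<and>
        (\<forall>d\<in>{1..<n}. lab d = i \<longrightarrow> fold_class k ((e * d) mod n) = c)" if i: "i \<in> {1..k}" for i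
  proof -
    have J_distinct: "1 \<noteq> 2 * j" "1 \<noteq> 2 * j + 1" "2 * j \<noteq> 2 * j + 1" using j2 by auto
    have good: "good_class k 1" "good_class k 2" "good_class k 3"
      using j j2 unfolding good_class_def by presburger+
    have lab_J: "fold_class k d \<in> J \<and> fold_class k ((3 * d) mod n) \<in> {1, 2, 3}"
      if "d \<in> {1..<n}" "lab d \<in> J" for d
      using that third_class[of d] unfolding lab_def by (auto split: if_splits)
    consider "i = 1" | "i = 2 * j" | "i = 2 * j + 1" | "i \<notin> J" by (auto simp: J_def)
    then show ?thesis
    proof cases
      case 1
      have "fold_class k ((3 * d) mod n) = 1" if "d \<in> {1..<n}" "lab d = 1" for d
        using that lab_J[of d] J_distinct by (auto simp: lab_def J_def split: if_splits)
      then show ?thesis using cop good 1 by blast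
    next
      case 2
      have "fold_class k ((3 * d) mod n) = 2" if "d \<in> {1..<n}" "lab d = 2 * j" for d
        using that lab_J[of d] J_distinct by (auto simp: lab_def J_def split: if_splits)
      then show ?thesis using cop good 2 by blast
    next
      case 3
      have "fold_class k ((3 * d) mod n) = 3" if "d \<in> {1..<n}" "lab d = 2 * j + 1" for d
        using that lab_J[of d] J_distinct by (auto simp: lab_def J_def split: if_splits)
      then show ?thesis using cop good 3 by blast
    next
      case 4
      have "fold_class k ((1 * d) mod n) = i" if "d \<in> {1..<n}" "lab d = i" for d
        using that 4 by (auto simp: lab_def J_def split: if_splits)
      moreover have "good_class k i" using i 4 j j2 by (auto simp: good_class_def J_def)
      ultimately show ?thesis using coprime_1_left by blast
    qed
  qed
  ultimately show ?thesis unfolding good_labelling_def by blast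
qed

section \<open>From labellings to circle graphs\<close>

section \<open>Circle graphs\<close>

text \<open>The midpoint lies in \<open>H\<close>, not merely in \<open>C\<close>, because arcs of
  \<open>H\<close> end in vertices of \<open>H\<close>; \<open>two_step\<close> asks for exactly
  this.\<close>

lemma diameter_two_subgraph_step:
  assumes H: "diameter_two_subgraph H (with_proj C)" and xy: "x \<in> verts H" "y \<in> verts H" "x \<noteq> y"
  shows "(x, y) \<in> parcs C \<or> (\<exists>w\<in>verts H. (x, w) \<in> parcs C \<and> (w, y) \<in> parcs C)"
proof -
  have sub: "subgraph H (with_proj C)" using H by (simp add: diameter_two_subgraph_def)
  have wf: "wf_digraph H" using sub by (simp add: subgraph_def)
  have ends: "tail H = fst" "head H = snd" using sub by (auto simp: subgraph_def compatible_def)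
  have arcs: "arcs H \<subseteq> parcs C" using sub by (auto simp: subgraph_def)
  obtain p where p: "pre_digraph.apath H x p y" "length p \<le> 2"
    using H xy by (auto simp: diameter_two_subgraph_def)
  have walk: "set p \<subseteq> arcs H" "pre_digraph.cas H x p y"
    using p(1) by (auto simp: pre_digraph.apath_def pre_digraph.awalk_def)
  have cas: "pre_digraph.cas H u [] v \<longleftrightarrow> u = v"
    "pre_digraph.cas H u (e # es) v \<longleftrightarrow> fst e = u \<and> pre_digraph.cas H (snd e) es v" for u v e es
    by (simp_all add: pre_digraph.cas.simps ends)
  consider "p = []" | e where "p = [e]" | e e' where "p = [e, e']"
    using p(2) by (cases p rule: remdups_adj.cases) auto
  then show ?thesis
  proof cases
    case 1
    then show ?thesis using walk(2) xy(3) by (simp add: cas)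
  next
    case (2 e)
    then show ?thesis using walk arcs by (cases e) (auto simp: cas)
  next
    case (3 e e')
    have "snd e \<in> verts H"
      using wf_digraph.head_in_verts[OF wf, of e] walk(1) 3 by (simp add: ends)
    then show ?thesis using walk arcs 3 by (cases e; cases e') (auto simp: cas)
  qed
qed

lemma mod_diff_in_range:
  fixes x y n :: int
  assumes "x \<in> {0..<n}" "y \<in> {0..<n}" "x \<noteq> y"
  shows "(x - y) mod n \<in> {1..<n}"
proof -
  have "x mod n \<noteq> y mod n" using assms by simp
  then have "(x - y) mod n \<noteq> 0" by (simp add: mod_eq_dvd_iff dvd_eq_mod_eq_0)
  moreover have "0 \<le> (x - y) mod n" "(x - y) mod n < n" using assms by auto
  ultimately show ?thesis unfolding atLeastLessThan_iff by linarith
qed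

text \<open>Exactly one of d and \<open>int N - d\<close> lies in \<open>{1..m}\<close>, and both
  carry the same label, so a connection set within the lower half captures all arcs of a
  label.\<close>

lemma parcs_circle_graph_labelling:
  assumes N: "int N = 2 * m + 1"
    and lab: "\<And>d. d \<in> {1..<int N} \<Longrightarrow> lab (int N - d) = lab d"
  shows "parcs (circle_graph N {d \<in> {1..m}. lab d = i}) =
    {(x, y). x \<in> {0..<int N} \<and> y \<in> {0..<int N} \<and> x \<noteq> y \<and> lab ((x - y) mod int N) = i}"
proof -
  have "(x - y) mod int N \<in> {d \<in> {1..m}. lab d = i} \<or> (y - x) mod int N \<in> {d \<in> {1..m}. lab d = i} \<longleftrightarrow>
      x \<noteq> y \<and> lab ((x - y) mod int N) = i"
    if xy: "x \<in> {0..<int N}" "y \<in> {0..<int N}" for x y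
  proof (cases "x = y")
    case True
    then show ?thesis by simp
  next
    case False
    define d where "d = (x - y) mod int N"
    have d: "d \<in> {1..<int N}" unfolding d_def by (rule mod_diff_in_range[OF xy False])
    then have "d \<noteq> 0" by simp
    have "(y - x) mod int N = (- (x - y)) mod int N" by simp
    also have "\<dots> = int N - d"
      using \<open>d \<noteq> 0\<close> unfolding d_def by (subst zmod_zminus1_eq_if) simp
    finally have d': "(y - x) mod int N = int N - d" .
    show ?thesis using d lab[OF d] N False unfolding d' d_def[symmetric] by auto
  qed
  then show ?thesis unfolding circle_graph_def by auto
qed

theorem theorem3:
  fixes k s n :: nat and G :: "int pair_pre_digraph"
  assumes "k \<ge> 4" and "s \<ge> 1"
    and "n = 2 * s * k + 1"
    and "complete_digraph n (with_proj G)" and "pverts G = {0..<int n}"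
  shows "\<exists>C :: nat \<Rightarrow> int pair_pre_digraph.
    (\<forall>i \<in> {1..k}. is_circle_graph n (C i)) \<and>
    disjoint_family_on (\<lambda>i. parcs (C i)) {1..k} \<and>
    partition_on (parcs G) ((\<lambda>i. parcs (C i)) ` {1..k}) \<and>
    (\<forall>i \<in> {1..k}. \<forall>H. diameter_two_subgraph H (with_proj (C i)) \<longrightarrow> card (verts H) \<le> 2 * s + 7)"
proof -
  define m where "m = int s * int k"
  have nm: "int n = 2 * m + 1" using assms(3) by (simp add: m_def)
  have nk: "int n = 2 * int k * int s + 1" using assms(3) by simp
  have "\<exists>lab. good_labelling (int k) (int n) lab"
    using ex_good_labelling_3_dvd[of "int k" "int s" "int n"]
      ex_good_labelling_not_3_dvd[of "int k" "int s" "int n"] assms(1,2) nk by fastforce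
  then obtain lab where lab: "good_labelling (int k) (int n) lab" by blast
  have sym: "lab (int n - d) = lab d" if "d \<in> {1..<int n}" for d
    using lab that by (simp add: good_labelling_def)
  define C where "C i = circle_graph n {d \<in> {1..m}. lab d = int i}" for i :: nat
  have arcs: "parcs (C i) = {(x, y). x \<in> {0..<int n} \<and> y \<in> {0..<int n} \<and> x \<noteq> y \<and>
      lab ((x - y) mod int n) = int i}" for i
    unfolding C_def by (rule parcs_circle_graph_labelling[where lab = lab, OF nm sym])
  have mpos: "m \<ge> 1" using mult_mono[of 1 "int s" 1 "int k"] assms(1,2) by (simp add: m_def)
  have "\<lfloor>real n / 2\<rfloor> = m"
  proof -
    have "real n = real_of_int (2 * m + 1)" using nm by (metis of_int_of_nat_eq)
    then show ?thesis by (simp add: floor_eq_iff)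
  qed
  then have circle: "is_circle_graph n (C i)" for i
    unfolding is_circle_graph_def C_def using nm mpos
    by (intro conjI exI[of _ "{d \<in> {1..m}. lab d = int i}"]) auto
  have disj: "disjoint_family_on (\<lambda>i. parcs (C i)) {1..k}"
    unfolding disjoint_family_on_def arcs by auto
  have G: "parcs G = {(x, y). x \<in> {0..<int n} \<and> y \<in> {0..<int n} \<and> x \<noteq> y}"
    using assms(4,5) unfolding complete_digraph_pair_def by auto
  have part: "partition_on (parcs G) ((\<lambda>i. parcs (C i)) ` {1..k})"
  proof (rule partition_onI)
    have index: "\<exists>i\<in>{1..k}. lab d = int i" if "d \<in> {1..<int n}" for d
    proof -
      have "1 \<le> lab d" "lab d \<le> int k" using lab that by (simp_all add: good_labelling_def)
      then show ?thesis by (intro bexI[of _ "nat (lab d)"]) auto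
    qed
    show "\<Union> ((\<lambda>i. parcs (C i)) ` {1..k}) = parcs G"
    proof (intro equalityI subsetI)
      fix a assume "a \<in> \<Union> ((\<lambda>i. parcs (C i)) ` {1..k})"
      then show "a \<in> parcs G" by (auto simp: arcs G)
    next
      fix a assume a: "a \<in> parcs G"
      then obtain x y where xy: "a = (x, y)" "x \<in> {0..<int n}" "y \<in> {0..<int n}" "x \<noteq> y"
        by (auto simp: G)
      then obtain i where "i \<in> {1..k}" "lab ((x - y) mod int n) = int i"
        using index[OF mod_diff_in_range] by blast
      then show "a \<in> \<Union> ((\<lambda>i. parcs (C i)) ` {1..k})" using xy by (auto simp: arcs)
    qed
  next
    fix p q assume "p \<in> (\<lambda>i. parcs (C i)) ` {1..k}" "q \<in> (\<lambda>i. parcs (C i)) ` {1..k}" "p \<noteq> q"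
    then show "disjnt p q" unfolding arcs disjnt_def by auto
  next
    show "{} \<notin> (\<lambda>i. parcs (C i)) ` {1..k}"
    proof
      assume "{} \<in> (\<lambda>i. parcs (C i)) ` {1..k}"
      then obtain i where i: "i \<in> {1..k}" "parcs (C i) = {}" by auto
      then have "int i \<in> {1..int k}" by simp
      \<comment> \<open>A distance \<open>d\<close> with label \<open>i\<close> yields the arc from
        \<open>d\<close> to 0.\<close>
      then obtain d where d: "d \<in> {1..<int n}" "lab d = int i"
        using lab unfolding good_labelling_def by blast
      then have "(d, 0) \<in> parcs (C i)" unfolding arcs by simp
      then show False using i(2) by simp
    qed
  qed
  have bound: "card (verts H) \<le> 2 * s + 7"
    if i: "i \<in> {1..k}" and H: "diameter_two_subgraph H (with_proj (C i))" for i H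
  proof -
    have "int i \<in> {1..int k}" using i by simp
    then obtain e c where ec: "coprime e (int n)" "good_class (int k) c"
      "\<And>d. d \<in> {1..<int n} \<Longrightarrow> lab d = int i \<Longrightarrow> fold_class (int k) ((e * d) mod int n) = c"
      using lab unfolding good_labelling_def by blast
    have E: "fold_class (int k) ((e * (x - y)) mod int n) = c" if "(x, y) \<in> parcs (C i)" for x y
    proof -
      have "fold_class (int k) ((e * ((x - y) mod int n)) mod int n) = c"
        using that ec(3) mod_diff_in_range unfolding arcs by auto
      then show ?thesis by (simp add: mod_mult_right_eq)
    qed
    have "verts H \<subseteq> pverts (C i)"
      using H by (auto simp: diameter_two_subgraph_def subgraph_def)
    then have V: "verts H \<subseteq> {0..<int n}" by (simp add: C_def circle_graph_def)
    have "int (card (verts H)) \<le> 2 * int s + 7"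
      by (rule card_diameter_two_le[where E = "\<lambda>x y. (x, y) \<in> parcs (C i)", OF _ _ nk ec(1,2) E V])
        (use assms(1,2) diameter_two_subgraph_step[OF H] in auto)
    then show ?thesis by linarith
  qed
  show ?thesis using circle disj part bound by blast
qed

end
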